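(* For every word $\omega$ of positive integers, $\mathrm{des}(\omega)=\mathrm{exc}(\Gamma(\omega))$.
   Context: For a word $\omega=a_1\cdots a_n$, $\mathrm{des}(\omega)=\#\{i:1\le i\le n-1,\ a_i>a_{i+1}\}$, and $\mathrm{exc}(\omega)=\#\{i: a_i>x_i\}$ where $x_1\le\cdots\le x_n$ is the nondecreasing rearrangement of the letters of $\omega$. Steingrímsson's map $\phi$ on permutations: for a permutation $\pi=\pi_1\cdots\pi_n$ of $[n]$ set $\pi_0=0$, and define $\phi(\pi)=f(1)f(2)\cdots f(n)$ as follows, for each $k=1,\dots,n$: (1) if there is $m$ with $k<m\le n$ and $\pi_m<\pi_k$, set $f(\pi_{k+1})=\pi_k$; (2) if $\pi_k<\pi_m$ for all $k<m\le n$, set $f(\pi_{j+1})=\pi_k$, where $j$ is the largest index in $\{0,1,\dots,k-1\}$ with $\pi_j<\pi_k$. The standardization of $\omega=a_1\cdots a_n$ is the permutation $\beta_\omega(1)\cdots\beta_\omega(n)$ with $\beta_\omega(i)=\#\{j: a_j<a_i\}+\#\{j\le i: a_j=a_i\}$. The map $\Gamma$: let $\pi$ be the standardization of $\omega$ and $\phi(\pi)=f(1)\cdots f(n)$; for each $i$ let $j_i$ be the unique index with $\beta_\omega(j_i)=f(i)$; then $\Gamma(\omega)=a_{j_1}a_{j_2}\cdots a_{j_n}$. (Example: $\omega=132232131$ has standardization $174586293$, $\phi(174586293)=169748253$, and $\Gamma(\omega)=123323121$.) *)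

theory Defs
  imports Main
begin

text \<open>
  Words are lists, with letters indexed from 0 by \<^term>\<open>(!)\<close>; so the \<open>i\<close>-th letter, counted from 1,
  is \<open>w ! (i - 1)\<close>.  A permutation of \<open>{1..n}\<close> is given in one-line notation as a list of naturals.
\<close>

definition des :: "'a::linorder list \<Rightarrow> nat" where
  "des w = card {i. Suc i < length w \<and> w ! i > w ! Suc i}"

definition exc :: "'a::linorder list \<Rightarrow> nat" where
  "exc w = card {i. i < length w \<and> w ! i > sort w ! i}"

definition standardization :: "'a::linorder list \<Rightarrow> nat list" where
  "standardization w =
     map (\<lambda>i. card {j. j < length w \<and> w ! j < w ! i} + card {j. j \<le> i \<and> w ! j = w ! i})
       [0..<length w]"

text \<open>One-line notation indexed from 1, extended by the convention that entry 0 is 0.\<close>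

definition entry :: "nat list \<Rightarrow> nat \<Rightarrow> nat" where
  "entry p i = (0 # p) ! i"

text \<open>
  For \<open>1 \<le> k \<le> n\<close>, \<open>phi_pos p k\<close> is the argument at which Steingrimsson's function \<open>f\<close> takes the
  value \<open>entry p k\<close>: the two branches are the two clauses of the rule defining \<open>f\<close>.
\<close>

definition phi_pos :: "nat list \<Rightarrow> nat \<Rightarrow> nat" where
  "phi_pos p k =
     (if \<exists>m. k < m \<and> m \<le> length p \<and> entry p m < entry p k
      then entry p (k + 1)
      else entry p ((GREATEST j. j < k \<and> entry p j < entry p k) + 1))"

text \<open>
  \<open>f(i)\<close> is the letter \<open>entry p k\<close> for the unique \<open>k\<close> whose clause assigns a value at \<open>i\<close>.
\<close>

definition phi :: "nat list \<Rightarrow> nat list" where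
  "phi p = map (\<lambda>i. entry p (THE k. 1 \<le> k \<and> k \<le> length p \<and> phi_pos p k = i)) [1..<length p + 1]"

definition Gamma :: "'a::linorder list \<Rightarrow> 'a list" where
  "Gamma w =
     map (\<lambda>v. w ! (THE j. j < length w \<and> standardization w ! j = v)) (phi (standardization w))"

end

theory Submission
  imports Defs "HOL-Library.Multiset"
begin

text \<open>
  Let \<open>\<pi>\<close> be the standardization of \<open>w\<close>, \<open>L v\<close> the letter of \<open>w\<close> that \<open>v\<close> replaces, and \<open>f = \<phi>(\<pi>)\<close>.
  Since \<open>L 1, ..., L n\<close> is the sorted word and \<open>f\<close> is a permutation, an excedance of
  \<open>\<Gamma>(w)\<close> is an \<open>i\<close> with \<open>L (f i) > L i\<close>.  Write \<open>i\<close> as the argument at which \<open>f\<close> takes the value \<open>\<pi>\<^sub>k\<close>.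
  In clause (2) of the rule \<open>i \<ge> \<pi>\<^sub>k\<close>, so monotonicity of \<open>L\<close> excludes an excedance; in
  clause (1) \<open>i = \<pi>\<^sub>k\<^sub>+\<^sub>1\<close>, so the condition reads \<open>w\<^sub>k > w\<^sub>k\<^sub>+\<^sub>1\<close>.  Conversely every descent falls under
  clause (1).
\<close>

lemma entry_Suc [simp]: "entry p (Suc i) = p ! i"
  by (simp add: entry_def)

lemma entry_0 [simp]: "entry p 0 = 0"
  by (simp add: entry_def)

section \<open>Steingrimsson's map on a permutation\<close>

locale perm_list =
  fixes p :: "nat list"
  assumes dist: "distinct p" and set_p: "set p = {1..length p}"
begin

abbreviation "n \<equiv> length p"

lemma entry_in: "1 \<le> k \<Longrightarrow> k \<le> n \<Longrightarrow> entry p k \<in> {1..n}"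
  using set_p nth_mem[of "k - 1" p] by (cases k) auto

lemma entry_inj: "i \<le> n \<Longrightarrow> j \<le> n \<Longrightarrow> entry p i = entry p j \<Longrightarrow> i = j"
proof -
  have "distinct (0 # p)"
    using dist set_p by auto
  then show "i \<le> n \<Longrightarrow> j \<le> n \<Longrightarrow> entry p i = entry p j \<Longrightarrow> i = j"
    unfolding entry_def by (subst (asm) nth_eq_iff_index_eq) auto
qed

definition prev :: "nat \<Rightarrow> nat" where
  "prev k = (GREATEST j. j < k \<and> entry p j < entry p k)"

definition non_min :: "nat \<Rightarrow> bool" where
  "non_min k \<longleftrightarrow> (\<exists>m. k < m \<and> m \<le> n \<and> entry p m < entry p k)"

text \<open>Both clauses have the form \<open>entry p (Suc _)\<close>, so injectivity of
  \<open>phi_pos\<close> reduces to injectivity of the chosen index.\<close>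

lemma phi_pos_eq: "phi_pos p k = entry p (Suc (if non_min k then k else prev k))"
  unfolding phi_pos_def prev_def non_min_def by auto

lemma non_min_less: "non_min k \<Longrightarrow> k < n"
  by (auto simp: non_min_def)

lemma prev:
  assumes "1 \<le> k" "k \<le> n"
  shows "prev k < k" "entry p (prev k) < entry p k"
    and "\<And>j. j < k \<Longrightarrow> entry p j < entry p k \<Longrightarrow> j \<le> prev k"
proof -
  \<comment> \<open>The convention that entry 0 is 0 makes index 0 a candidate, so the greatest
    index exists.\<close>
  have *: "0 < k \<and> entry p 0 < entry p k"
    using assms entry_in[of k] by auto
  have "prev k < k \<and> entry p (prev k) < entry p k"
    unfolding prev_def by (rule GreatestI_nat[where b = k]) (use * in auto)
  then show "prev k < k" "entry p (prev k) < entry p k"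
    by auto
  show "j \<le> prev k" if "j < k" "entry p j < entry p k" for j
    unfolding prev_def by (rule Greatest_le_nat[where b = k]) (use that in auto)
qed

lemma phi_pos_in: "k \<in> {1..n} \<Longrightarrow> phi_pos p k \<in> {1..n}"
  unfolding phi_pos_eq
  using entry_in[of "Suc (if non_min k then k else prev k)"] prev(1)[of k] non_min_less[of k]
  by auto

text \<open>The position after \<open>prev k\<close> is either \<open>k\<close> itself or, by
  maximality of \<open>prev k\<close>, carries an entry that is not smaller.\<close>

lemma phi_pos_le:
  assumes "k \<in> {1..n}" "\<not> non_min k"
  shows "entry p k \<le> phi_pos p k"
proof (cases "Suc (prev k) = k")
  case False
  then have "\<not> entry p (Suc (prev k)) < entry p k"
    using prev(1)[of k] prev(3)[of k "Suc (prev k)"] assms by auto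
  then show ?thesis
    using assms by (simp add: phi_pos_eq del: entry_Suc)
qed (use assms in \<open>simp add: phi_pos_eq del: entry_Suc\<close>)

text \<open>Clauses (1) and (2) never collide. If \<open>k = prev l\<close>, a later entry below
  \<open>entry p k\<close> is also below \<open>entry p l\<close>: before \<open>l\<close> it
  contradicts maximality of \<open>prev l\<close>, after \<open>l\<close> it contradicts clause (2)
  for \<open>l\<close>.\<close>

lemma non_min_neq_prev:
  assumes "k \<in> {1..n}" "l \<in> {1..n}" "non_min k" "\<not> non_min l"
  shows "k \<noteq> prev l"
proof
  assume k: "k = prev l"
  obtain m where m: "k < m" "m \<le> n" "entry p m < entry p k"
    using assms(3) by (auto simp: non_min_def)
  have "k < l" "entry p k < entry p l"
    using prev[of l] assms k by auto
  moreover have "\<not> m < l"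
    using prev(3)[of l m] assms(2) m k \<open>entry p k < entry p l\<close> by auto
  ultimately have "l < m" "entry p m < entry p l"
    using m by (auto simp: not_less le_less)
  then show False
    using assms(4) m by (auto simp: non_min_def)
qed

text \<open>Two uses of clause (2) never collide: no entry after \<open>k\<close> is smaller, so
  \<open>k\<close> is a candidate for \<open>prev l\<close>, and
  \<open>prev k < k \<le> prev l\<close>.\<close>

lemma prev_strict_mono:
  assumes "k < l" "k \<in> {1..n}" "l \<in> {1..n}" "\<not> non_min k"
  shows "prev k < prev l"
proof -
  have "entry p k \<noteq> entry p l"
    using entry_inj[of k l] assms by auto
  then have "entry p k < entry p l"
    using assms by (auto simp: non_min_def)
  then show ?thesis
    using prev(1)[of k] prev(3)[of l k] assms by auto
qed

lemma phi_pos_inj: "inj_on (phi_pos p) {1..n}"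
proof (rule inj_onI)
  fix k l assume kl: "k \<in> {1..n}" "l \<in> {1..n}" and eq: "phi_pos p k = phi_pos p l"
  have "Suc (if non_min k then k else prev k) = Suc (if non_min l then l else prev l)"
    using eq unfolding phi_pos_eq
    by (rule entry_inj[rotated 2]) (use kl prev(1)[of k] prev(1)[of l] non_min_less[of k] non_min_less[of l] in auto)
  then show "k = l"
    using kl non_min_neq_prev[of k l] non_min_neq_prev[of l k]
      prev_strict_mono[of k l] prev_strict_mono[of l k]
    by (cases k l rule: linorder_cases) (auto split: if_splits)
qed

lemma phi_pos_bij: "bij_betw (phi_pos p) {1..n} {1..n}"
  unfolding bij_betw_def
  by (intro conjI endo_inj_surj phi_pos_inj image_subsetI phi_pos_in) simp

lemma length_phi [simp]: "length (phi p) = n"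
  by (simp add: phi_def del: upt_Suc)

text \<open>Injectivity of \<open>phi_pos\<close> resolves the description in \<open>phi\<close>;
  the \<open>- 1\<close> turns an argument counted from 1 into a list index.\<close>

lemma phi_phi_pos:
  assumes "k \<in> {1..n}"
  shows "phi p ! (phi_pos p k - 1) = entry p k"
proof -
  have "(THE l. 1 \<le> l \<and> l \<le> n \<and> phi_pos p l = phi_pos p k) = k"
    using assms phi_pos_inj by (intro the_equality) (auto dest: inj_onD)
  then show ?thesis
    using phi_pos_in[OF assms] by (auto simp: phi_def simp del: upt_Suc)
qed

text \<open>Every entry of \<open>p\<close> occurs in \<open>phi p\<close>; as the lengths agree,
  counting leaves no room for repetitions or other values.\<close>

lemma mset_phi: "mset (phi p) = mset p"
proof -
  have "set p \<subseteq> set (phi p)"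
  proof
    fix v assume "v \<in> set p"
    then obtain i where i: "i < n" "v = p ! i"
      by (metis in_set_conv_nth)
    then have "v = phi p ! (phi_pos p (Suc i) - 1)"
      using phi_phi_pos[of "Suc i"] by auto
    then show "v \<in> set (phi p)"
      using phi_pos_in[of "Suc i"] i by auto
  qed
  moreover have "card (set p) = n"
    using dist distinct_card by blast
  ultimately have "set p = set (phi p)"
    using card_length[of "phi p"] by (intro card_seteq) auto
  moreover from this have "distinct (phi p)"
    using \<open>card (set p) = n\<close> by (intro card_distinct) auto
  ultimately show ?thesis
    using dist set_eq_iff_mset_eq_distinct by metis
qed

end

section \<open>Standardization as a permutation\<close>

lemma length_standardization [simp]: "length (standardization w) = length w"
  by (simp add: standardization_def)

lemma standardization_less:
  fixes w :: "'a::linorder list"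
  assumes "i < length w" "j < length w" "w ! i < w ! j \<or> w ! i = w ! j \<and> i < j"
  shows "standardization w ! i < standardization w ! j"
proof -
  \<comment> \<open>\<open>A k \<union> B k\<close> is the set of positions weakly below
    \<open>k\<close> when positions are ordered by letter, ties broken from left to right. Going up
    in this order adds at least the new position itself.\<close>
  define A where "A k = {l. l < length w \<and> w ! l < w ! k}" for k
  define B where "B k = {l. l \<le> k \<and> w ! l = w ! k}" for k
  have fin: "finite (A k)" "finite (B k)" for k
    unfolding A_def B_def by auto
  have s: "standardization w ! k = card (A k \<union> B k)" if "k < length w" for k
  proof -
    have "A k \<inter> B k = {}"
      by (auto simp: A_def B_def)
    then show ?thesis
      using that fin by (simp add: standardization_def card_Un_disjoint flip: A_def B_def)
  qed
  have "A i \<union> B i \<subseteq> A j \<union> B j"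
    using assms by (auto simp: A_def B_def)
  moreover have "j \<in> A j \<union> B j" "j \<notin> A i \<union> B i"
    using assms by (auto simp: A_def B_def)
  ultimately have "A i \<union> B i \<subset> A j \<union> B j"
    by blast
  then show ?thesis
    using fin assms s by (metis finite_UnI psubset_card_mono)
qed

lemma standardization_less_iff:
  fixes w :: "'a::linorder list"
  assumes "i < length w" "j < length w"
  shows "standardization w ! i < standardization w ! j \<longleftrightarrow> w ! i < w ! j \<or> w ! i = w ! j \<and> i < j"
  using standardization_less[OF assms] standardization_less[OF assms(2,1)]
  by (metis linorder_less_linear order_less_asym)

lemma distinct_standardization: "distinct (standardization w)"
  unfolding distinct_conv_nth
  using standardization_less_iff[of _ w] by (metis length_standardization linorder_less_linear less_irrefl)

lemma set_standardization: "set (standardization w) = {1..length w}"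
proof (rule card_seteq)
  show "set (standardization w) \<subseteq> {1..length w}"
  proof
    fix v assume "v \<in> set (standardization w)"
    then obtain i where i: "i < length w"
      and v: "v = card {j. j < length w \<and> w ! j < w ! i} + card {j. j \<le> i \<and> w ! j = w ! i}"
      by (auto simp: standardization_def)
    have "v = card ({j. j < length w \<and> w ! j < w ! i} \<union> {j. j \<le> i \<and> w ! j = w ! i})"
      unfolding v by (subst card_Un_disjoint) auto
    also have "\<dots> \<le> card {..<length w}"
      using i by (intro card_mono) auto
    finally have "v \<le> length w"
      by simp
    moreover have "0 < card {j. j \<le> i \<and> w ! j = w ! i}"
      by (subst card_gt_0_iff) auto
    ultimately show "v \<in> {1..length w}"
      using v by auto
  qed
  show "card {1..length w} \<le> card (set (standardization w))"
    using distinct_standardization[of w] by (simp add: distinct_card)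
qed simp

lemma perm_list_standardization: "perm_list (standardization w)"
  by unfold_locales (simp_all add: distinct_standardization set_standardization)

section \<open>Recovering letters, and the sorted form of \<open>Gamma w\<close>\<close>

definition letter :: "'a::linorder list \<Rightarrow> nat \<Rightarrow> 'a" where
  "letter w v = w ! (THE j. j < length w \<and> standardization w ! j = v)"

lemma letter_nth:
  assumes "i < length w"
  shows "letter w (standardization w ! i) = w ! i"
proof -
  have "(THE j. j < length w \<and> standardization w ! j = standardization w ! i) = i"
    using assms distinct_standardization[of w]
    by (intro the_equality) (auto simp: nth_eq_iff_index_eq)
  then show ?thesis
    by (simp add: letter_def)
qed

lemma Gamma_eq: "Gamma w = map (letter w) (phi (standardization w))"
  by (simp add: Gamma_def letter_def)

text \<open>Standardization compares letters before positions, so a strictly larger letter cannot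
  receive a smaller value.\<close>

lemma letter_mono:
  assumes "u \<in> {1..length w}" "v \<in> {1..length w}" "u \<le> v"
  shows "letter w u \<le> letter w v"
proof -
  obtain i j where ij: "i < length w" "u = standardization w ! i"
    "j < length w" "v = standardization w ! j"
    using assms(1,2) unfolding set_standardization[symmetric]
    by (metis in_set_conv_nth length_standardization)
  then show ?thesis
    using assms(3) standardization_less_iff[of j w i] by (force simp: letter_nth)
qed

text \<open>\<open>phi\<close> only rearranges the values from 1 to the length of \<open>w\<close>,
  and \<open>letter w\<close> is monotone on them.\<close>

lemma sort_Gamma: "sort (Gamma w) = map (letter w) [1..<length w + 1]"
proof (rule properties_for_sort)
  have "mset (standardization w) = mset [1..<length w + 1]"
    by (subst set_eq_iff_mset_eq_distinct[symmetric])
      (auto simp: distinct_standardization set_standardization)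
  then show "mset (map (letter w) [1..<length w + 1]) = mset (Gamma w)"
    by (simp add: Gamma_eq perm_list.mset_phi[OF perm_list_standardization] del: upt_Suc)
  show "sorted (map (letter w) [1..<length w + 1])"
    by (auto simp: sorted_iff_nth_mono nth_append simp del: upt_Suc intro!: letter_mono)
qed

section \<open>Matching excedances with descents\<close>

theorem des_eq_exc_Gamma:
  fixes w :: "'a::linorder list"
  shows "des w = exc (Gamma w)"
proof -
  define s where "s = standardization w"
  interpret perm_list s
    unfolding s_def by (rule perm_list_standardization)
  have n: "n = length w"
    by (simp add: s_def)
  \<comment> \<open>The excedances of \<open>Gamma w\<close>, indexed by the \<open>k\<close> whose
    entry is placed there instead of by their position.\<close>
  define D where "D = {k \<in> {1..n}. letter w (phi_pos s k) < letter w (entry s k)}"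
  have "bij_betw (\<lambda>k. phi_pos s k - 1) D {i. i < n \<and> letter w (Suc i) < letter w (phi s ! i)}"
  proof (rule bij_betwI')
    show "(phi_pos s k - 1 = phi_pos s l - 1) = (k = l)" if "k \<in> D" "l \<in> D" for k l
      using that phi_pos_in[of k] phi_pos_in[of l] phi_pos_inj unfolding D_def
      by (auto simp: inj_on_def)
    show "phi_pos s k - 1 \<in> {i. i < n \<and> letter w (Suc i) < letter w (phi s ! i)}"
      if "k \<in> D" for k
      using that phi_pos_in[of k] phi_phi_pos[of k] unfolding D_def by auto
    show "\<exists>k\<in>D. i = phi_pos s k - 1"
      if i: "i \<in> {i. i < n \<and> letter w (Suc i) < letter w (phi s ! i)}" for i
    proof -
      have "Suc i \<in> phi_pos s ` {1..n}"
        using i phi_pos_bij by (auto simp: bij_betw_def)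
      then obtain k where k: "k \<in> {1..n}" "phi_pos s k = Suc i"
        by (metis imageE)
      then show ?thesis
        using i phi_phi_pos[of k] by (intro bexI[of _ k]) (auto simp: D_def)
    qed
  qed
  moreover have "exc (Gamma w) = card {i. i < n \<and> letter w (Suc i) < letter w (phi s ! i)}"
    unfolding exc_def sort_Gamma n
    by (intro arg_cong[where f = card] Collect_cong) (auto simp: Gamma_eq n simp flip: s_def simp del: upt_Suc)
  ultimately have "exc (Gamma w) = card D"
    using bij_betw_same_card by fastforce
  \<comment> \<open>The shift by \<open>Suc\<close> arises because \<open>D\<close> counts positions
    from 1 and \<open>des\<close> from 0.\<close>
  moreover have "D = Suc ` {i. Suc i < length w \<and> w ! i > w ! Suc i}" (is "_ = Suc ` ?E")
  proof (rule set_eqI)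
    fix k
    show "k \<in> D \<longleftrightarrow> k \<in> Suc ` ?E"
    proof (cases "k \<in> {1..n}")
      case True
      then obtain i where i: "k = Suc i" "i < length w"
        using n by (cases k) auto
      show ?thesis
      proof (cases "non_min k")
        case True
        then have "Suc i < length w"
          using non_min_less i n by auto
        \<comment> \<open>In clause (1) the comparison defining \<open>D\<close> is between the
          letters at \<open>Suc i\<close> and \<open>i\<close>, which is the descent
          condition.\<close>
        moreover have "phi_pos s k = s ! Suc i"
          using True i by (simp add: phi_pos_eq)
        ultimately show ?thesis
          using i \<open>k \<in> {1..n}\<close> by (auto simp: D_def s_def letter_nth)
      next
        case False
        have "letter w (entry s k) \<le> letter w (phi_pos s k)"
          using phi_pos_le[OF \<open>k \<in> {1..n}\<close> False] \<open>k \<in> {1..n}\<close> n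
          using phi_pos_in[of k] entry_in[of k] by (intro letter_mono) auto
        then have "k \<notin> D"
          by (simp add: D_def leD)
        moreover have "i \<notin> ?E"
        proof
          assume "i \<in> ?E"
          then have "non_min k"
            unfolding non_min_def using i n
            \<comment> \<open>The witness is the next position, counted from 1: a descent of
              \<open>w\<close> remains one after standardization.\<close>
            by (intro exI[of _ "Suc (Suc i)"]) (auto simp: s_def standardization_less_iff)
          with False show False ..
        qed
        ultimately show ?thesis
          using i by auto
      qed
    qed (auto simp: D_def n)
  qed
  ultimately show ?thesis
    by (simp add: des_def card_image)
qed

theorem theorem3p2:
  fixes w :: "nat list"
  assumes "\<forall>a\<in>set w. 0 < a"
  shows "des w = exc (Gamma w)"
  by (rule des_eq_exc_Gamma)

end
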